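(* For all integers $n>k\geq 0$, let $Q_n^{(k)}(x)$ denote the $k$th derivative of $Q_n(x)$ (with $Q_n^{(0)}=Q_n$). Then \[ {\rm Disc}\big(Q_n^{(k)}(x)\big)=(-1)^\varepsilon\frac{n+k+1}{\binom{2n}{n+k}} \left(\frac{(n+k)!}{(n-k)!}\binom{2n}{n}(2n+1)\right)^{n-k-1}, \] where $\varepsilon=(n-k)(n-k-1)/2$. In particular, for $n\geq 1$, \[ {\rm Disc}(Q_n(x))=(-1)^{\frac{n(n-1)}{2}}(n+1)(2n+1)^{n-1}\binom{2n}{n}^{n-2}. \]
   Context: For each integer $n\geq 0$, $P_n(x),Q_n(x)\in\mathbb{Q}[x]$ denote the unique pair of polynomials with $\deg P_n\leq n$, $\deg Q_n\leq n$ satisfying $P_n(x)x^{n+1}+Q_n(x)(x+1)^{n+1}=1$. For a polynomial $f(x)=a_mx^m+\cdots+a_0$ with $a_m\neq 0$ and roots $\theta_1,\dots,\theta_m$, and a polynomial $g$, the resultant is $R(f,g)=a_m^{\deg g}\prod_{i=1}^m g(\theta_i)$, and the discriminant is ${\rm Disc}(f)=(-1)^{m(m-1)/2}a_m^{-1}R(f,f')$. *)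

theory Defs
  imports
    "HOL-Computational_Algebra.Computational_Algebra"
begin

definition bezout_pair :: "nat \<Rightarrow> rat poly \<Rightarrow> rat poly \<Rightarrow> bool" where
  "bezout_pair n P Q \<longleftrightarrow>
     degree P \<le> n \<and> degree Q \<le> n \<and>
     P * [:0, 1:] ^ (n + 1) + Q * [:1, 1:] ^ (n + 1) = 1"

definition PQ_pair :: "nat \<Rightarrow> rat poly \<times> rat poly" where
  "PQ_pair n = (THE (P, Q). bezout_pair n P Q)"

definition P_poly :: "nat \<Rightarrow> rat poly" where
  "P_poly n = fst (PQ_pair n)"

definition Q_poly :: "nat \<Rightarrow> rat poly" where
  "Q_poly n = snd (PQ_pair n)"


lemma bezout_pair_unique:
  assumes "bezout_pair n P Q" "bezout_pair n P' Q'"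
  shows "P = P' \<and> Q = Q'"
proof -
  let ?a = "[:0, 1:] ^ (n + 1) :: rat poly" and ?b = "[:1, 1:] ^ (n + 1) :: rat poly"
  have eq: "P * ?a + Q * ?b = 1" "P' * ?a + Q' * ?b = 1"
    and deg: "degree Q \<le> n" "degree Q' \<le> n"
    using assms by (simp_all add: bezout_pair_def)
  have "Q - Q' = (Q - Q') * (P * ?a + Q * ?b)"
    using eq by simp
  also have "\<dots> = (Q - Q') * P * ?a + Q * ((P' - P) * ?a + (P * ?a + Q * ?b) - (P' * ?a + Q' * ?b))"
    by (simp add: algebra_simps)
  also have "\<dots> = ((Q - Q') * P + Q * (P' - P)) * ?a"
    unfolding eq by (simp add: algebra_simps)
  finally have "?a dvd Q - Q'" by (metis dvd_triv_right)
  moreover have "degree (Q - Q') \<le> n" using deg by (rule degree_diff_le)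
  moreover have "degree ?a = n + 1" by (simp only: degree_linear_power)
  ultimately have Q: "Q = Q'"
    using dvd_imp_degree_le[of ?a "Q - Q'"] by fastforce
  with eq have "P * ?a = P' * ?a" by (metis add_right_cancel)
  hence "P = P'" by (subst (asm) mult_cancel_right) auto
  with Q show ?thesis by simp
qed

lemma bezout_power:
  fixes a b :: "'a :: comm_ring_1"
  assumes "u * a + v * b = 1"
  shows "\<exists>u' v'. u' * a + v' * b ^ m = 1"
proof (induction m)
  case 0
  have "0 * a + 1 * b ^ 0 = 1" by simp
  thus ?case by blast
next
  case (Suc m)
  then obtain u' v' where uv': "u' * a + v' * b ^ m = 1" by blast
  have "(u + v * b * u') * a + (v * v') * b ^ Suc m = u * a + v * b * (u' * a + v' * b ^ m)"
    by (simp add: algebra_simps)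
  also have "\<dots> = 1" using assms uv' by simp
  finally show ?case by blast
qed

lemma bezout_pair_exists: "\<exists>P Q. bezout_pair n P Q"
proof -
  let ?a = "[:0, 1:] ^ (n + 1) :: rat poly" and ?b = "[:1, 1:] ^ (n + 1) :: rat poly"
  have da: "degree ?a = n + 1" "degree ?b = n + 1" by (simp_all only: degree_linear_power)
  have a0: "?a \<noteq> 0" by simp
  have "(-1) * [:0, 1:] + 1 * [:1, 1:] = (1 :: rat poly)" by (simp add: one_pCons)
  then obtain u v where "u * [:0, 1:] + v * ?b = 1"
    using bezout_power by blast
  then obtain u v where uv: "u * ?a + v * ?b = 1"
    using bezout_power[of v ?b u "[:0, 1:]" "n + 1"] by (metis add.commute)
  define Q where "Q = v mod ?a"
  define P where "P = u + (v div ?a) * ?b"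
  have "P * ?a + Q * ?b = u * ?a + (v div ?a * ?a + v mod ?a) * ?b"
    unfolding P_def Q_def by (simp add: algebra_simps)
  also have "\<dots> = 1" by (simp only: div_mult_mod_eq uv)
  finally have eq: "P * ?a + Q * ?b = 1" .
  have dQ: "degree Q \<le> n"
    using degree_mod_less[OF a0, of v] da unfolding Q_def by auto
  have "P * ?a = 1 - Q * ?b" using eq by (metis add_diff_cancel_right')
  moreover have "degree (1 - Q * ?b) \<le> n + (n + 1)"
    using degree_mult_le[of Q ?b] dQ da by (intro degree_diff_le) auto
  ultimately have "degree (P * ?a) \<le> n + (n + 1)" by simp
  hence "degree P \<le> n"
    using degree_mult_eq[OF _ a0, of P] da by (cases "P = 0") auto
  with dQ eq show ?thesis unfolding bezout_pair_def by blast
qed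

lemma bezout_pair_P_Q: "bezout_pair n (P_poly n) (Q_poly n)"
proof -
  have "\<exists>!x. case x of (P, Q) \<Rightarrow> bezout_pair n P Q"
    using bezout_pair_exists[of n] bezout_pair_unique[of n] by fast
  from theI'[OF this] show ?thesis
    unfolding PQ_pair_def[symmetric] P_poly_def Q_poly_def by (simp only: split_beta)
qed

text \<open>The roots are the complex roots, counted with multiplicity.\<close>

definition poly_res :: "complex poly \<Rightarrow> complex poly \<Rightarrow> complex" where
  "poly_res f g = lead_coeff f ^ degree g * (\<Prod>\<theta>\<in>#proots f. poly g \<theta>)"

definition poly_disc :: "complex poly \<Rightarrow> complex" where
  "poly_disc f =
     (-1) ^ (degree f * (degree f - 1) div 2) * inverse (lead_coeff f) * poly_res f (pderiv f)"

end

theory Submission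
  imports Defs
begin

text \<open>
  Differentiating the Bezout identity shows that \<open>x\<^sup>n\<close> divides \<open>(1 + x) Q' + (n + 1) Q\<close>, a
  polynomial of degree at most \<open>n\<close>, which is thus a constant multiple of \<open>x\<^sup>n\<close>. Taking \<open>k\<close> further
  derivatives, \<open>f = Q\<^sup>(\<^sup>k\<^sup>)\<close> satisfies \<open>(1 + x) f' + (n + k + 1) f = c x\<^sup>m\<close> with \<open>m = n - k = deg f\<close>.
  At a root \<open>\<theta>\<close> of \<open>f\<close> this reads \<open>(1 + \<theta>) f'(\<theta>) = c \<theta>\<^sup>m\<close>; the product over all roots expresses
  the resultant of \<open>f\<close> and \<open>f'\<close> through \<open>f(0)\<close> and \<open>f(-1)\<close>, and \<open>f(-1)\<close> is read off the same
  equation at \<open>x = -1\<close>.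
\<close>

section \<open>Products over roots and discriminants\<close>

lemma poly_eq_prod_proots:
  fixes f :: "complex poly"
  shows "poly f x = lead_coeff f * (\<Prod>\<theta>\<in>#proots f. x - \<theta>)"
proof -
  have "poly f x = poly (smult (lead_coeff f) (\<Prod>\<theta>\<in>#proots f. [:-\<theta>, 1:])) x"
    by (simp only: complex_poly_decompose_multiset)
  thus ?thesis by (simp add: poly_prod_mset)
qed

lemma prod_mset_power:
  fixes g :: "'b \<Rightarrow> 'a :: comm_monoid_mult"
  shows "(\<Prod>x\<in>#A. g x ^ m) = (\<Prod>x\<in>#A. g x) ^ m"
  by (induction A) (simp_all add: power_mult_distrib)

lemma prod_mset_uminus:
  fixes g :: "'b \<Rightarrow> 'a :: comm_ring_1"
  shows "(\<Prod>x\<in>#A. - g x) = (-1) ^ size A * (\<Prod>x\<in>#A. g x)"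
  by (induction A) simp_all

text \<open>The conclusion is grouped as a ratio times an \<open>(m - 1)\<close>-st power because,
  for derivatives of \<open>Q_poly n\<close>, the ratio becomes a reciprocal binomial coefficient
  and \<open>c * coeff f 0\<close> becomes the base of the final power up to sign.\<close>

lemma poly_disc_of_ode:
  fixes f :: "complex poly"
  assumes deg: "degree f = m" and m: "m > 0"
    and ode: "[:1, 1:] * pderiv f + smult s f = monom c m"
    and s: "s \<noteq> 0" and c: "c \<noteq> 0"
  shows "poly_disc f = (-1) ^ (m * (m - 1) div 2) * s *
           ((-1) ^ m * coeff f 0 / lead_coeff f) * (c * coeff f 0) ^ (m - 1)"
proof -
  define a where "a = lead_coeff f"
  define T where "T = (\<Prod>\<theta>\<in>#proots f. \<theta>)"
  define U where "U = (\<Prod>\<theta>\<in>#proots f. 1 + \<theta>)"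
  define D where "D = (\<Prod>\<theta>\<in>#proots f. poly (pderiv f) \<theta>)"
  have f0: "f \<noteq> 0" using deg m by auto
  have a0: "a \<noteq> 0" using f0 by (simp add: a_def)
  have size: "size (proots f) = m" by (simp add: size_proots_complex deg)
  have T: "coeff f 0 = a * ((-1) ^ m * T)"
    using poly_eq_prod_proots[of f 0] prod_mset_uminus[of "\<lambda>x. x" "proots f"]
    by (simp add: size a_def T_def poly_0_coeff_0)
  have "(\<Prod>\<theta>\<in>#proots f. - 1 - \<theta>) = (-1) ^ m * U"
    using prod_mset_uminus[of "\<lambda>x. 1 + x" "proots f"] by (simp add: size U_def)
  hence U: "poly f (-1) = a * ((-1) ^ m * U)"
    using poly_eq_prod_proots[of f "-1"] by (simp add: a_def)
  have "s * poly f (-1) = c * (-1) ^ m"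
    using arg_cong[OF ode, of "\<lambda>p. poly p (-1)"] by (simp add: poly_monom)
  hence "s * a * U = c" unfolding U by (simp add: field_simps)
  hence U_eq: "U = c / (s * a)" using s a0 by (simp add: field_simps)
  have "(1 + \<theta>) * poly (pderiv f) \<theta> = c * \<theta> ^ m" if "\<theta> \<in># proots f" for \<theta>
    using arg_cong[OF ode, of "\<lambda>p. poly p \<theta>"] that f0 by (simp add: poly_monom algebra_simps)
  hence "(\<Prod>\<theta>\<in>#proots f. (1 + \<theta>) * poly (pderiv f) \<theta>) = (\<Prod>\<theta>\<in>#proots f. c * \<theta> ^ m)"
    by (intro arg_cong[where f = prod_mset] image_mset_cong)
  hence "U * D = c ^ m * T ^ m"
    by (simp add: prod_mset.distrib U_def D_def T_def prod_mset_power size)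
  \<comment> \<open>Since \<open>U = c / (s * a)\<close> is nonzero, dividing by it cancels one
    factor of \<open>c ^ m\<close>; this is where \<open>m > 0\<close> enters.\<close>
  hence D: "D = s * a * c ^ (m - 1) * T ^ m"
    using c s a0 m by (simp add: U_eq field_simps power_eq_if[of c m])
  have "T = (-1) ^ m * coeff f 0 / a" using a0 by (simp add: T)
  \<comment> \<open>The sign \<open>(-1) ^ (m * m)\<close> is \<open>(-1) ^ m\<close>, as
    \<open>m * m\<close> and \<open>m\<close> have the same parity.\<close>
  hence Tm: "T ^ m = (-1) ^ m * coeff f 0 ^ m / a ^ m"
    by (simp add: power_divide power_mult_distrib flip: power_mult)
      (simp add: minus_one_power_iff)
  have "poly_disc f = (-1) ^ (m * (m - 1) div 2) * inverse a * (a ^ (m - 1) * D)"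
    by (simp add: poly_disc_def poly_res_def deg degree_pderiv D_def a_def)
  moreover have "inverse a * (a ^ (m - 1) * D) = s * ((-1) ^ m * coeff f 0 / a) * (c * coeff f 0) ^ (m - 1)"
    unfolding D Tm using a0 m
    by (cases m) (simp_all add: field_simps power_mult_distrib)
  ultimately show ?thesis by (simp add: a_def mult.assoc)
qed

section \<open>Coefficients of the Bezout cofactor\<close>

text \<open>This is the vanishing of the coefficient of \<open>x^j\<close> in \<open>W\<close>,
  which holds because \<open>x^n\<close> divides \<open>W\<close>.\<close>

lemma coeff_Q_poly_rec:
  assumes "j < n"
  shows "of_nat (Suc j) * coeff (Q_poly n) (Suc j) = - of_nat (n + j + 1) * coeff (Q_poly n) j"
proof -
  let ?x = "[:0, 1:] :: rat poly" and ?y = "[:1, 1:] :: rat poly"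
  define P where "P = P_poly n"
  define Q where "Q = Q_poly n"
  define W where "W = ?y * pderiv Q + smult (of_nat (Suc n)) Q"
  have "P * ?x ^ Suc n + Q * ?y ^ Suc n = 1"
    using bezout_pair_P_Q[of n] by (simp add: bezout_pair_def P_def Q_def)
  hence "pderiv (P * ?x ^ Suc n) + pderiv (Q * ?y ^ Suc n) = 0"
    by (metis pderiv_1 pderiv_add)
  moreover have "pderiv (P * ?x ^ Suc n) =
      ?x ^ n * (?x * pderiv P + smult (of_nat (Suc n)) P)"
    by (simp only: pderiv_mult pderiv_power_Suc) (simp add: pderiv_pCons algebra_simps del: of_nat_Suc)
  moreover have "pderiv (Q * ?y ^ Suc n) = ?y ^ n * W"
    unfolding W_def
    by (simp only: pderiv_mult pderiv_power_Suc) (simp add: pderiv_pCons algebra_simps del: of_nat_Suc)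
  ultimately have "?y ^ n * W = ?x ^ n * - (?x * pderiv P + smult (of_nat (Suc n)) P)"
    by (metis add_eq_0_iff mult_minus_right)
  hence dvd: "monom 1 n dvd ?y ^ n * W" by (simp add: monom_altdef)
  \<comment> \<open>The factor \<open>?y ^ n\<close> does not vanish at 0, so \<open>W\<close> alone
    has a zero of order at least \<open>n\<close> there. The case \<open>W = 0\<close> is separate
    because orders add only for a nonzero product.\<close>
  have "monom 1 n dvd W"
  proof (cases "W = 0")
    case False
    hence "n \<le> order 0 (?y ^ n) + order 0 W"
      using dvd by (simp add: monom_1_dvd_iff order_mult)
    moreover have "order 0 (?y ^ n) = 0" by (rule order_0I) (simp add: poly_power)
    ultimately show ?thesis using False by (simp add: monom_1_dvd_iff)
  qed simp
  hence "coeff W j = 0"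
    using assms by (simp add: monom_1_dvd_iff')
  thus ?thesis
    by (cases j) (simp_all add: W_def Q_def coeff_pderiv algebra_simps eq_neg_iff_add_eq_0)
qed

lemma coeff_Q_poly_0: "coeff (Q_poly n) 0 = 1"
proof -
  have "poly (P_poly n * [:0, 1:] ^ (n + 1) + Q_poly n * [:1, 1:] ^ (n + 1)) 0 = 1"
    using bezout_pair_P_Q[of n] by (simp only: bezout_pair_def poly_1)
  thus ?thesis by (simp add: poly_power flip: poly_0_coeff_0)
qed

text \<open>These are the coefficients of the binomial series of \<open>(1 + x)^(-n-1)\<close>,
  truncated after degree \<open>n\<close>.\<close>

lemma coeff_Q_poly:
  assumes "j \<le> n"
  shows "coeff (Q_poly n) j = (-1) ^ j * fact (n + j) / (fact n * fact j)"
  using assms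
proof (induction j)
  case 0
  show ?case by (simp add: coeff_Q_poly_0)
next
  case (Suc j)
  hence "coeff (Q_poly n) (Suc j) = - of_nat (n + j + 1) * coeff (Q_poly n) j / of_nat (Suc j)"
    using coeff_Q_poly_rec[of j n] by (simp add: field_simps del: of_nat_Suc)
  also have "\<dots> = (-1) ^ Suc j * fact (n + Suc j) / (fact n * fact (Suc j))"
    using Suc by (simp add: divide_simps) (simp add: algebra_simps)
  finally show ?case .
qed

section \<open>Higher derivatives and their discriminants\<close>

context
  fixes n k :: nat and f :: "complex poly"
  assumes kn: "k < n"
  defines "f \<equiv> map_poly of_rat ((pderiv ^^ k) (Q_poly n))"
begin

lemma coeff_higher_pderiv_Q_poly:
  "coeff f j = (if j \<le> n - k then (-1) ^ (j + k) * fact (n + k + j) / (fact n * fact j) else 0)"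
proof -
  \<comment> \<open>Differentiating \<open>k\<close> times brings in this rising factorial; its
    numerator cancels the \<open>fact (j + k)\<close> in the denominator of
    \<open>coeff_Q_poly\<close>.\<close>
  have "(pochhammer (of_nat (Suc j)) k :: rat) = fact (j + k) / fact j"
    using pochhammer_product'[of "1 :: rat" j k]
    by (simp add: field_simps flip: pochhammer_fact)
  moreover have "degree (Q_poly n) \<le> n"
    using bezout_pair_P_Q[of n] by (simp add: bezout_pair_def)
  ultimately have "coeff ((pderiv ^^ k) (Q_poly n)) j =
      (if j \<le> n - k then (-1) ^ (j + k) * fact (n + k + j) / (fact n * fact j) else 0)"
    using kn by (auto simp: coeff_higher_pderiv coeff_Q_poly coeff_eq_0 add_ac simp del: of_nat_Suc)
  moreover have "of_rat (fact i) = (fact i :: complex)" for i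
    by (metis of_nat_fact of_rat_of_nat_eq)
  ultimately show ?thesis
    by (simp add: f_def coeff_map_poly of_rat_mult of_rat_divide of_rat_power of_rat_minus)
qed

lemma degree_higher_pderiv_Q_poly: "degree f = n - k"
  using kn by (intro antisym degree_le le_degree) (auto simp: coeff_higher_pderiv_Q_poly)

text \<open>The equation is checked coefficientwise from the closed form. Below degree
  \<open>n - k\<close> consecutive coefficients cancel; at \<open>n - k\<close> only the leading
  coefficient survives, with factor \<open>(n + k + 1) + (n - k)\<close>.\<close>

lemma higher_pderiv_Q_poly_ode:
  "[:1, 1:] * pderiv f + smult (of_nat (n + k + 1)) f =
     monom (of_nat (2 * n + 1) * lead_coeff f) (n - k)"
proof (rule poly_eqI)
  fix j
  have "coeff ([:1, 1:] * pderiv f + smult (of_nat (n + k + 1)) f) j =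
      of_nat (Suc j) * coeff f (Suc j) + of_nat (n + k + 1 + j) * coeff f j"
    by (cases j) (simp_all add: coeff_pderiv algebra_simps)
  also have "\<dots> = coeff (monom (of_nat (2 * n + 1) * lead_coeff f) (n - k)) j"
  proof (cases j "n - k" rule: linorder_cases)
    case less
    have "fact (n + k + Suc j) = (of_nat (n + k + 1 + j) * fact (n + k + j) :: complex)"
      by (simp add: algebra_simps)
    moreover have "of_nat (Suc j) * (x / (fact n * fact (Suc j))) = x / (fact n * fact j)"
      for x :: complex
      by (simp add: fact_Suc del: of_nat_Suc)
    ultimately show ?thesis using less
      by (simp add: coeff_higher_pderiv_Q_poly del: of_nat_Suc of_nat_add fact_Suc)
  next
    case equal
    hence "n + k + 1 + j = 2 * n + 1" using kn by simp
    thus ?thesis using equal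
      by (simp add: coeff_higher_pderiv_Q_poly degree_higher_pderiv_Q_poly del: of_nat_Suc)
  next
    case greater
    thus ?thesis by (simp add: coeff_higher_pderiv_Q_poly)
  qed
  finally show "coeff ([:1, 1:] * pderiv f + smult (of_nat (n + k + 1)) f) j = \<dots>" .
qed

lemma poly_disc_higher_pderiv_Q_poly:
  "poly_disc f =
     (-1) ^ ((n - k) * (n - k - 1) div 2) *
     (of_nat (n + k + 1) / of_nat ((2 * n) choose (n + k))) *
     (fact (n + k) / fact (n - k) * of_nat ((2 * n) choose n) * of_nat (2 * n + 1)) ^ (n - k - 1)"
proof -
  define m where "m = n - k"
  have m: "m > 0" "n = m + k" using kn by (simp_all add: m_def)
  define c where "c = of_nat (2 * n + 1) * lead_coeff f"
  define B :: complex where "B = fact (n + k) / fact m * of_nat ((2 * n) choose n) * of_nat (2 * n + 1)"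
  have lc: "lead_coeff f = (-1) ^ n * fact (2 * n) / (fact n * fact m)"
    using kn by (simp add: degree_higher_pderiv_Q_poly coeff_higher_pderiv_Q_poly m_def mult_2)
  have f0: "coeff f 0 = (-1) ^ k * fact (n + k) / fact n"
    by (simp add: coeff_higher_pderiv_Q_poly)
  have "c \<noteq> 0" unfolding c_def lc by (simp del: of_nat_add of_nat_mult of_nat_Suc)
  moreover have "of_nat (n + k + 1) \<noteq> (0 :: complex)" by (simp only: of_nat_eq_0_iff)
  ultimately have disc: "poly_disc f = (-1) ^ (m * (m - 1) div 2) * of_nat (n + k + 1) *
      ((-1) ^ m * coeff f 0 / lead_coeff f) * (c * coeff f 0) ^ (m - 1)"
    using higher_pderiv_Q_poly_ode degree_higher_pderiv_Q_poly m(1)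
    by (intro poly_disc_of_ode) (simp_all add: c_def m_def)
  have ratio: "(-1) ^ m * coeff f 0 / lead_coeff f = 1 / of_nat ((2 * n) choose (n + k))"
  proof -
    have "(-1) ^ m * (-1) ^ k = ((-1) ^ n :: complex)" by (simp add: m power_add)
    moreover have "of_nat ((2 * n) choose (n + k)) = (fact (2 * n) / (fact (n + k) * fact m) :: complex)"
      using kn by (subst binomial_fact) (simp_all add: m_def)
    ultimately show ?thesis by (simp add: lc f0 mult_ac)
  qed
  have base: "c * coeff f 0 = (-1) ^ m * B"
  proof -
    have "(-1) ^ n * (-1) ^ k = ((-1) ^ m :: complex)"
      by (simp add: m minus_one_power_iff)
    moreover have "of_nat ((2 * n) choose n) = (fact (2 * n) / (fact n * fact n) :: complex)"
      by (subst binomial_fact) simp_all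
    ultimately show ?thesis
      unfolding c_def lc f0 B_def by (simp add: mult_ac del: of_nat_add of_nat_mult of_nat_Suc)
  qed
  \<comment> \<open>The sign disappears because \<open>m * (m - 1)\<close> is even.\<close>
  have sign: "((-1) ^ m * B) ^ (m - 1) = B ^ (m - 1)"
  proof -
    have "((-1) ^ m) ^ (m - 1) = (1 :: complex)"
      by (simp add: minus_one_power_iff)
    thus ?thesis by (simp only: power_mult_distrib mult_1_left)
  qed
  show ?thesis
    unfolding disc ratio base sign unfolding B_def m_def by simp
qed

end

theorem theorem5p1:
  shows "(\<forall>n k :: nat. k < n \<longrightarrow>
            poly_disc (map_poly of_rat ((pderiv ^^ k) (Q_poly n))) =
              (-1) ^ ((n - k) * (n - k - 1) div 2) *
              (of_nat (n + k + 1) / of_nat ((2 * n) choose (n + k))) *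
              (fact (n + k) / fact (n - k) * of_nat ((2 * n) choose n) * of_nat (2 * n + 1))
                ^ (n - k - 1))
       \<and> (\<forall>n :: nat. 1 \<le> n \<longrightarrow>
            poly_disc (map_poly of_rat (Q_poly n)) =
              (-1) ^ (n * (n - 1) div 2) * of_nat (n + 1) * of_nat (2 * n + 1) ^ (n - 1) *
              of_nat ((2 * n) choose n) powi (int n - 2))"
proof (intro conjI allI impI)
  fix n k :: nat
  assume "k < n"
  thus "poly_disc (map_poly of_rat ((pderiv ^^ k) (Q_poly n))) =
      (-1) ^ ((n - k) * (n - k - 1) div 2) *
      (of_nat (n + k + 1) / of_nat ((2 * n) choose (n + k))) *
      (fact (n + k) / fact (n - k) * of_nat ((2 * n) choose n) * of_nat (2 * n + 1)) ^ (n - k - 1)"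
    by (rule poly_disc_higher_pderiv_Q_poly)
next
  fix n :: nat
  assume n: "1 \<le> n"
  define b :: complex where "b = of_nat ((2 * n) choose n)"
  have b0: "b \<noteq> 0" by (simp add: b_def)
  \<comment> \<open>The exponent is -1 at \<open>n = 1\<close>, hence \<open>powi\<close>. This
    splitting yields the natural power \<open>b ^ (n - 1)\<close> from the case
    \<open>k = 0\<close>, divided by \<open>b\<close>.\<close>
  have exponent: "int n - 2 = int (n - 1) - 1" using n by simp
  have "b powi (int n - 2) = b ^ (n - 1) / b"
    unfolding exponent using b0 by (subst power_int_diff) simp_all
  moreover have "poly_disc (map_poly of_rat (Q_poly n)) =
      (-1) ^ (n * (n - 1) div 2) * (of_nat (n + 1) / b) * (b * of_nat (2 * n + 1)) ^ (n - 1)"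
    using poly_disc_higher_pderiv_Q_poly[of 0 n] n by (simp add: b_def)
  ultimately show "poly_disc (map_poly of_rat (Q_poly n)) =
      (-1) ^ (n * (n - 1) div 2) * of_nat (n + 1) * of_nat (2 * n + 1) ^ (n - 1) *
      of_nat ((2 * n) choose n) powi (int n - 2)"
    by (simp add: power_mult_distrib flip: b_def)
qed

end
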